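(* Let $G=\varprojlim_{j\ge1}G_j$ be a profinite group with a tower of finite quotients and let $H_\bullet$ be a closed $N$-series of $G$ induced from the finite quotients, as specified in the context. Let $n\ge1$. For every $h=(h_j)_j\in H_n\cap D_{n+1}^{\rm fin}$, $$h\in D_{n+1}^{\rm alg}\iff \sup_j\mu_{n,j}(h)<\infty .$$
   Context: An $N$-series of a group $G$ is a descending chain of subgroups $G=H_1\ge H_2\ge\cdots$ with $[H_a,H_b]\le H_{a+b}$. For $m\ge1$, $A_m=A_m(G,H_\bullet)\subseteq\mathbf Z[G]$ is the additive subgroup of the (discrete, abstract) integral group ring generated by all products $(x_1-1)\cdots(x_r-1)$ with $x_\nu\in H_{a_\nu}$ and $\sum_\nu a_\nu\ge m$. Put $D_m^{\rm alg}=G\cap(1+A_m)$. Standing setting: $G=\varprojlim_{j\ge1}G_j$ is a separated countably based profinite group with a fixed descending cofinal tower of finite quotients $q_j:G\to G_j$ and surjective transition maps $G_{j+1}\to G_j$. The $N$-series $H_\bullet$ is closed and induced from the finite quotients: $H_a=\varprojlim_jH_{a,j}$ with $H_{a,j}=q_j(H_a)$, and the transition maps carry $H_{a,j+1}$ onto $H_{a,j}$. Let $A_{m,j}=A_m(G_j,H_{\bullet,j})\subseteq\mathbf Z[G_j]$, and $$D_m^{\rm fin}=\bigcap_jq_j^{-1}\bigl(G_j\cap(1+A_{m,j})\bigr).$$ For $h\in G$ write $h_j=q_j(h)$. Losey expressions: for a group $G$ with $N$-series $H_\bullet$, a degree-$(n+1)$ Losey expression $\mathcal W$ for $a\in A_{n+1}$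 is an equality $a=\sum_{u=1}^sc_u\prod_{v=1}^{r_u}(x_{u,v}-1)$ with $c_u\in\mathbf Z\setminus\{0\}$, $x_{u,v}\in H_{w_{u,v}}$ and $\sum_vw_{u,v}\ge n+1$ for every $u$ (the empty sum represents $0$). Its complexity (width) is $\|\mathcal W\|=\sum_{u=1}^s|c_u|(1+r_u)$. For $h\in H_n\cap D_{n+1}^{\rm alg}$, $\mu_n(G,H_\bullet;h)=\min\{\|\mathcal W\|:\mathcal W\text{ is a degree-}(n+1)\text{ Losey expression for }h-1\}$. For $h\in H_n\cap D_{n+1}^{\rm fin}$, $\mu_{n,j}(h)=\mu_n(G_j,H_{\bullet,j};h_j)$. *)

theory Defs
  imports
    "HOL-Analysis.Analysis"
    "HOL-Algebra.Ring"
    "HOL-Algebra.Free_Abelian_Groups"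
    "HOL-Library.Extended_Nat"
begin

section \<open>\<open>N\<close>-series\<close>

definition commutator_subgroup ::
    "('a, 'm) monoid_scheme \<Rightarrow> 'a set \<Rightarrow> 'a set \<Rightarrow> 'a set" where
  "commutator_subgroup G A B =
     generate G (\<Union>x\<in>A. \<Union>y\<in>B. {x \<otimes>\<^bsub>G\<^esub> y \<otimes>\<^bsub>G\<^esub> inv\<^bsub>G\<^esub> x \<otimes>\<^bsub>G\<^esub> inv\<^bsub>G\<^esub> y})"

text \<open>The terms of an \<open>N\<close>-series are indexed by the integers \<open>a \<ge> 1\<close>; the value \<open>H 0\<close> is irrelevant
  here and in every definition below.\<close>

definition N_series :: "('a, 'm) monoid_scheme \<Rightarrow> (nat \<Rightarrow> 'a set) \<Rightarrow> bool" where
  "N_series G H \<longleftrightarrow>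
     H 1 = carrier G \<and>
     (\<forall>a\<ge>1. subgroup (H a) G \<and> H (Suc a) \<subseteq> H a) \<and>
     (\<forall>a\<ge>1. \<forall>b\<ge>1. commutator_subgroup G (H a) (H b) \<subseteq> H (a + b))"

section \<open>The integral group ring and its filtration\<close>

text \<open>\<open>\<int>[G]\<close> is the free abelian group on \<open>carrier G\<close> (finitely supported integer-valued functions,
  with \<^term>\<open>frag_of g\<close> the basis element of \<open>g\<close>), with the multiplication of \<open>G\<close> extended
  bilinearly.\<close>

definition group_ring :: "('a, 'm) monoid_scheme \<Rightarrow> ('a \<Rightarrow>\<^sub>0 int) ring" where
  "group_ring G =
     \<lparr>carrier = {c. Poly_Mapping.keys c \<subseteq> carrier G},
      monoid.mult = (\<lambda>a b. frag_extend (\<lambda>x. frag_extend (\<lambda>y. frag_of (x \<otimes>\<^bsub>G\<^esub> y)) b) a),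
      one = frag_of \<one>\<^bsub>G\<^esub>,
      ring.zero = 0,
      ring.add = (+)\<rparr>"

lemma ring_group_ring:
  assumes "group G"
  shows "ring (group_ring G)"
proof -
  interpret group G by fact
  let ?m = "\<lambda>a b. frag_extend (\<lambda>x. frag_extend (\<lambda>y. frag_of (x \<otimes>\<^bsub>G\<^esub> y)) b) a"
  have ext_add: "frag_extend (\<lambda>x. f x + g x) a = frag_extend f a + frag_extend g a"
    for f g :: "'a \<Rightarrow> ('a \<Rightarrow>\<^sub>0 int)" and a
    by (simp add: frag_extend_def frag_cmul_distrib2 sum.distrib)
  have ext_diff: "frag_extend (\<lambda>x. f x - g x) a = frag_extend f a - frag_extend g a"
    for f g :: "'a \<Rightarrow> ('a \<Rightarrow>\<^sub>0 int)" and a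
    using ext_add[of "\<lambda>x. f x - g x" g a] by (simp add: eq_diff_eq)
  have ext_zero: "frag_extend (\<lambda>x. 0) a = (0 :: 'a \<Rightarrow>\<^sub>0 int)" for a :: "'a \<Rightarrow>\<^sub>0 int"
    by (simp add: frag_extend_eq_0)
  have closed: "Poly_Mapping.keys (?m a b) \<subseteq> carrier G"
    if "Poly_Mapping.keys a \<subseteq> carrier G" "Poly_Mapping.keys b \<subseteq> carrier G" for a b
  proof -
    have "Poly_Mapping.keys (frag_extend (\<lambda>y. frag_of (x \<otimes>\<^bsub>G\<^esub> y)) b) \<subseteq> carrier G"
      if "x \<in> carrier G" for x
      using keys_frag_extend[of "\<lambda>y. frag_of (x \<otimes>\<^bsub>G\<^esub> y)" b] that \<open>Poly_Mapping.keys b \<subseteq> carrier G\<close>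
      by fastforce
    then show ?thesis
      using keys_frag_extend[of "\<lambda>x. frag_extend (\<lambda>y. frag_of (x \<otimes>\<^bsub>G\<^esub> y)) b" a] that by blast
  qed
  have assoc: "?m (?m a b) c = ?m a (?m b c)"
    if a: "Poly_Mapping.keys a \<subseteq> carrier G" and b: "Poly_Mapping.keys b \<subseteq> carrier G"
      and c: "Poly_Mapping.keys c \<subseteq> carrier G" for a b c
    using a
  proof (induction a rule: frag_induction)
    case (one x)
    from b show ?case
    proof (induction b rule: frag_induction)
      case (one y)
      from c show ?case
        by (induction c rule: frag_induction)
           (use \<open>x \<in> carrier G\<close> one in \<open>simp_all add: frag_extend_diff ext_diff ext_zero m_assoc\<close>)
    qed (simp_all add: frag_extend_diff ext_diff ext_zero)
  qed (simp_all add: frag_extend_diff ext_diff ext_zero)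
  have l_one: "?m (frag_of \<one>\<^bsub>G\<^esub>) a = a" if "Poly_Mapping.keys a \<subseteq> carrier G" for a
    using that by (induction a rule: frag_induction) (simp_all add: frag_extend_diff ext_diff ext_zero)
  have r_one: "?m a (frag_of \<one>\<^bsub>G\<^esub>) = a" if "Poly_Mapping.keys a \<subseteq> carrier G" for a
    using that by (induction a rule: frag_induction) (simp_all add: frag_extend_diff ext_diff ext_zero)
  have minus: "\<exists>y. Poly_Mapping.keys y \<subseteq> carrier G \<and> y + x = 0"
    if "Poly_Mapping.keys x \<subseteq> carrier G" for x :: "'a \<Rightarrow>\<^sub>0 int"
    using that by (intro exI[of _ "- x"]) simp
  show ?thesis
  proof (rule ringI)
    show "abelian_group (group_ring G)"
      by (rule abelian_groupI)
         (use minus in \<open>auto simp: group_ring_def ac_simps dest: subsetD[OF keys_add]\<close>)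
    show "Group.monoid (group_ring G)"
      by (rule monoidI) (use closed assoc l_one r_one in \<open>auto simp: group_ring_def\<close>)
  qed (auto simp: group_ring_def frag_extend_add ext_add)
qed

text \<open>A product \<open>(x\<^sub>1 - 1) \<cdots> (x\<^sub>r - 1)\<close> is given by the list of pairs \<open>(w\<^sub>\<nu>, x\<^sub>\<nu>)\<close> of weights and
  elements \<open>x\<^sub>\<nu> \<in> H w\<^sub>\<nu>\<close>.\<close>

definition weighted_factors :: "(nat \<Rightarrow> 'a set) \<Rightarrow> nat \<Rightarrow> (nat \<times> 'a) list \<Rightarrow> bool" where
  "weighted_factors H m ws \<longleftrightarrow>
     (\<forall>(w, x)\<in>set ws. 1 \<le> w \<and> x \<in> H w) \<and> m \<le> sum_list (map fst ws)"

definition aug_prod :: "('a, 'm) monoid_scheme \<Rightarrow> (nat \<times> 'a) list \<Rightarrow> ('a \<Rightarrow>\<^sub>0 int)" where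
  "aug_prod G ws =
     foldr (\<lambda>(w, x) p. (frag_of x - frag_of \<one>\<^bsub>G\<^esub>) \<otimes>\<^bsub>group_ring G\<^esub> p) ws \<one>\<^bsub>group_ring G\<^esub>"

definition A_filt ::
    "('a, 'm) monoid_scheme \<Rightarrow> (nat \<Rightarrow> 'a set) \<Rightarrow> nat \<Rightarrow> ('a \<Rightarrow>\<^sub>0 int) set" where
  "A_filt G H m =
     generate (add_monoid (group_ring G)) (aug_prod G ` {ws. weighted_factors H m ws})"

definition D_alg :: "('a, 'm) monoid_scheme \<Rightarrow> (nat \<Rightarrow> 'a set) \<Rightarrow> nat \<Rightarrow> 'a set" where
  "D_alg G H m = {g \<in> carrier G. frag_of g \<in> (\<lambda>a. frag_of \<one>\<^bsub>G\<^esub> + a) ` A_filt G H m}"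

section \<open>Losey expressions\<close>

text \<open>An expression is the list of its terms \<open>(c\<^sub>u, [(w\<^sub>u\<^sub>1, x\<^sub>u\<^sub>1), \<dots>])\<close>.\<close>

type_synonym 'a losey_terms = "(int \<times> (nat \<times> 'a) list) list"

definition losey_value :: "('a, 'm) monoid_scheme \<Rightarrow> 'a losey_terms \<Rightarrow> ('a \<Rightarrow>\<^sub>0 int)" where
  "losey_value G W = (\<Sum>(c, ws)\<leftarrow>W. frag_cmul c (aug_prod G ws))"

definition losey_expression ::
    "('a, 'm) monoid_scheme \<Rightarrow> (nat \<Rightarrow> 'a set) \<Rightarrow> nat \<Rightarrow> ('a \<Rightarrow>\<^sub>0 int) \<Rightarrow> 'a losey_terms \<Rightarrow> bool" where
  "losey_expression G H d a W \<longleftrightarrow>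
     (\<forall>(c, ws)\<in>set W. c \<noteq> 0 \<and> weighted_factors H d ws) \<and> a = losey_value G W"

definition losey_width :: "'a losey_terms \<Rightarrow> nat" where
  "losey_width W = (\<Sum>(c, ws)\<leftarrow>W. nat \<bar>c\<bar> * (1 + length ws))"

text \<open>The infimum is an attained minimum as soon as \<open>h \<in> D_alg G H (n + 1)\<close>.\<close>

definition losey_mu :: "('a, 'm) monoid_scheme \<Rightarrow> (nat \<Rightarrow> 'a set) \<Rightarrow> nat \<Rightarrow> 'a \<Rightarrow> nat" where
  "losey_mu G H n h =
     Inf (losey_width ` {W. losey_expression G H (n + 1) (frag_of h - frag_of \<one>\<^bsub>G\<^esub>) W})"

section \<open>Profinite groups with a tower of finite quotients\<close>

definition inverse_limit ::
    "(nat \<Rightarrow> ('b, 'k) monoid_scheme) \<Rightarrow> (nat \<Rightarrow> 'b \<Rightarrow> 'b) \<Rightarrow> (nat \<Rightarrow> 'b) monoid" where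
  "inverse_limit Q t =
     product_group {1..} Q
       \<lparr>carrier := {x \<in> carrier (product_group {1..} Q). \<forall>j\<ge>1. t j (x (Suc j)) = x j}\<rparr>"

text \<open>\<open>G\<close> is the limit of the finite groups \<open>Q j\<close>, \<open>j \<ge> 1\<close>, along the transition maps
  \<open>t j : Q (j + 1) \<rightarrow> Q j\<close>, with projections \<open>q j\<close>. Separatedness is the injectivity contained in
  \<open>limit\<close>; the topology is the one induced by the product of the discrete groups \<open>Q j\<close>.\<close>

locale profinite_tower = group G
  for G :: "('a, 'm) monoid_scheme" (structure)
    and Q :: "nat \<Rightarrow> ('b, 'k) monoid_scheme"
    and t :: "nat \<Rightarrow> 'b \<Rightarrow> 'b"
    and q :: "nat \<Rightarrow> 'a \<Rightarrow> 'b" +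
  assumes finite_group: "j \<ge> 1 \<Longrightarrow> group (Q j) \<and> finite (carrier (Q j))"
    and transition: "j \<ge> 1 \<Longrightarrow> t j \<in> epi (Q (Suc j)) (Q j)"
    and quotient: "j \<ge> 1 \<Longrightarrow> q j \<in> epi G (Q j)"
    and limit: "(\<lambda>g. \<lambda>j\<in>{1..}. q j g) \<in> iso G (inverse_limit Q t)"

definition profinite_topology ::
    "('a, 'm) monoid_scheme \<Rightarrow> (nat \<Rightarrow> ('b, 'k) monoid_scheme) \<Rightarrow> (nat \<Rightarrow> 'a \<Rightarrow> 'b) \<Rightarrow> 'a topology"
  where
  "profinite_topology G Q q =
     pullback_topology (carrier G) (\<lambda>g. \<lambda>j\<in>{1..}. q j g)
       (product_topology (\<lambda>j. discrete_topology (carrier (Q j))) {1..})"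

definition quotient_series :: "(nat \<Rightarrow> 'a \<Rightarrow> 'b) \<Rightarrow> (nat \<Rightarrow> 'a set) \<Rightarrow> nat \<Rightarrow> nat \<Rightarrow> 'b set" where
  "quotient_series q H j a = q j ` H a"

text \<open>\<open>induced\<close> says that \<open>H a\<close> is the inverse limit of its images in the \<open>Q j\<close>, as a subset of \<open>G\<close>.\<close>

locale closed_induced_N_series = profinite_tower G Q t q
  for G :: "('a, 'm) monoid_scheme" (structure)
    and Q :: "nat \<Rightarrow> ('b, 'k) monoid_scheme"
    and t :: "nat \<Rightarrow> 'b \<Rightarrow> 'b"
    and q :: "nat \<Rightarrow> 'a \<Rightarrow> 'b" +
  fixes H :: "nat \<Rightarrow> 'a set"
  assumes N_series: "N_series G H"
    and closed: "a \<ge> 1 \<Longrightarrow> closedin (profinite_topology G Q q) (H a)"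
    and induced: "a \<ge> 1 \<Longrightarrow> H a = {g \<in> carrier G. \<forall>j\<ge>1. q j g \<in> quotient_series q H j a}"
    and transition_series: "\<lbrakk>a \<ge> 1; j \<ge> 1\<rbrakk> \<Longrightarrow>
          t j ` quotient_series q H (Suc j) a = quotient_series q H j a"

definition D_fin ::
    "('a, 'm) monoid_scheme \<Rightarrow> (nat \<Rightarrow> ('b, 'k) monoid_scheme) \<Rightarrow> (nat \<Rightarrow> 'a \<Rightarrow> 'b) \<Rightarrow>
     (nat \<Rightarrow> 'a set) \<Rightarrow> nat \<Rightarrow> 'a set" where
  "D_fin G Q q H m = {g \<in> carrier G. \<forall>j\<ge>1. q j g \<in> D_alg (Q j) (quotient_series q H j) m}"

end

theory Submission
  imports Defs
begin

text \<open>A Losey expression for \<open>h - 1\<close> in \<open>\<int>[G]\<close> projects to every \<open>G\<^sub>j\<close> without changing its width.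
  Conversely, since \<open>H w \<subseteq> H (n + 1)\<close> for \<open>w > n + 1\<close>, weights can be capped at \<open>n + 1\<close>, so that at
  every level there are only finitely many expressions of bounded width. By Koenig's lemma a uniform
  bound yields a compatible family of expressions, which lifts to an expression over \<open>G\<close>; its value
  is \<open>h - 1\<close> because an element of \<open>\<int>[G]\<close> has finite support, hence is detected at some finite level.\<close>

section \<open>Inverse limits of finite sets\<close>

text \<open>Choose one point in each \<open>A k\<close>. Finiteness of \<open>A 0\<close> makes some
  point recur for infinitely many indices, and monotonicity then puts it into every
  \<open>A k\<close>.\<close>

lemma decreasing_finite_Inter_nonempty:
  fixes A :: "nat \<Rightarrow> 'c set"
  assumes "finite (A 0)" "\<And>k. A k \<noteq> {}" "\<And>k. A (Suc k) \<subseteq> A k"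
  shows "(\<Inter>k. A k) \<noteq> {}"
proof -
  have anti: "A l \<subseteq> A k" if "k \<le> l" for k l
    using lift_Suc_antimono_le[of A, OF assms(3) that] .
  define y where "y k = (SOME x. x \<in> A k)" for k
  have y: "y k \<in> A k" for k
    unfolding y_def using assms(2)[of k] by (simp add: some_in_eq)
  have "finite (range y)"
  proof (rule finite_subset)
    show "range y \<subseteq> A 0" using y anti[of 0] by blast
  qed fact
  then obtain k0 where inf: "infinite {k. y k = y k0}"
    using pigeonhole_infinite[of UNIV y] by auto
  have "y k0 \<in> A k" for k
  proof -
    obtain l where "l \<ge> k" "y l = y k0"
      using inf unfolding infinite_nat_iff_unbounded_le by blast
    then show ?thesis using y[of l] anti[of k l] by auto
  qed
  then show ?thesis by blast
qed

text \<open>Koenig's lemma in inverse-limit form. The maps need not be surjective between the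
  \<open>E j\<close>, but they become so on the subsets of points that lift to every height, and
  there a thread can be chosen step by step.\<close>

lemma inverse_limit_finite_nonempty:
  fixes E :: "nat \<Rightarrow> 'c set" and f :: "nat \<Rightarrow> 'c \<Rightarrow> 'c"
  assumes fin: "\<And>j. finite (E j)" and ne: "\<And>j. E j \<noteq> {}"
    and maps: "\<And>j. f j ` E (Suc j) \<subseteq> E j"
  obtains x where "\<And>j. x j \<in> E j" "\<And>j. f j (x (Suc j)) = x j"
proof -
  \<comment> \<open>\<open>P k j\<close> is the image of \<open>E (j + k)\<close> in
    \<open>E j\<close> under \<open>k\<close> successive maps. The intersection \<open>S j\<close>
    below consists of the points that lift to every finite height.\<close>
  define P where "P = rec_nat (\<lambda>j. E j) (\<lambda>k S j. f j ` S (Suc j))"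
  have P0: "P 0 j = E j" and PS: "P (Suc k) j = f j ` P k (Suc j)" for k j
    by (simp_all add: P_def)
  have Pne: "P k j \<noteq> {}" for k j
    by (induction k arbitrary: j) (simp_all add: P0 PS ne)
  have Pdec: "P (Suc k) j \<subseteq> P k j" for k j
  proof (induction k arbitrary: j)
    case 0
    show ?case unfolding PS unfolding P0 by (rule maps)
  next
    case (Suc k)
    show ?case unfolding PS[of "Suc k"] PS[of k j] by (rule image_mono) (rule Suc.IH)
  qed
  define S where "S j = (\<Inter>k. P k j)" for j
  have Sne: "S j \<noteq> {}" for j
    unfolding S_def by (rule decreasing_finite_Inter_nonempty) (auto simp: P0 fin Pne dest: subsetD[OF Pdec])
  have step: "\<exists>y. y \<in> S (Suc j) \<and> f j y = x" if "x \<in> S j" for x j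
  proof -
    \<comment> \<open>A single preimage must serve all heights at once. The fibres over
      \<open>x\<close> are finite and decreasing, and nonempty because \<open>x\<close> lies in
      \<open>P (Suc k) j\<close>, so the intersection lemma applies again.\<close>
    have "(\<Inter>k. {y \<in> P k (Suc j). f j y = x}) \<noteq> {}"
    proof (rule decreasing_finite_Inter_nonempty)
      show "{y \<in> P k (Suc j). f j y = x} \<noteq> {}" for k
        using that unfolding S_def by (auto simp: PS dest!: spec[of _ "Suc k"])
    qed (auto simp: P0 fin dest: subsetD[OF Pdec])
    then show ?thesis unfolding S_def by blast
  qed
  obtain x where "\<And>j. x j \<in> S j \<and> f j (x (Suc j)) = x j"
    using dependent_nat_choice[of "\<lambda>j x. x \<in> S j" "\<lambda>j x y. f j y = x"] Sne step by blast
  moreover have "S j \<subseteq> E j" for j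
    unfolding S_def using P0 by (metis INF_lower UNIV_I)
  ultimately show ?thesis using that by blast
qed

section \<open>Lifting compatible lists and pairs through a tower\<close>

text \<open>Mapping preserves length, so all \<open>xs j\<close> are equally long and can be lifted
  entry by entry. The abstract assumption \<open>lift\<close> has the same shape as the conclusion,
  which allows nesting with \<open>lift_compatible_pairs\<close>.\<close>

lemma lift_compatible_lists:
  fixes q :: "nat \<Rightarrow> 'a \<Rightarrow> 'b" and t :: "nat \<Rightarrow> 'b \<Rightarrow> 'b"
  assumes lift: "\<And>x. (\<And>j. j \<ge> 1 \<Longrightarrow> x j \<in> C j \<and> t j (x (Suc j)) = x j) \<Longrightarrow>
                    \<exists>y\<in>Y. \<forall>j\<ge>1. q j y = x j"
    and xs: "\<And>j. j \<ge> 1 \<Longrightarrow> xs j \<in> lists (C j) \<and> map (t j) (xs (Suc j)) = xs j"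
  shows "\<exists>ys\<in>lists Y. \<forall>j\<ge>1. map (q j) ys = xs j"
  using xs
proof (induction "length (xs 1)" arbitrary: xs)
  case 0
  have "xs j = []" if "j \<ge> 1" for j
    using that
  proof (induction j rule: dec_induct)
    case base
    then show ?case using 0 by simp
  next
    case (step j)
    then show ?case using "0.prems"[of j] by simp
  qed
  then show ?case by (intro bexI[of _ "[]"]) auto
next
  case (Suc k)
  have len: "length (xs j) = Suc k" if "j \<ge> 1" for j
    using that
  proof (induction j rule: dec_induct)
    case base
    then show ?case using Suc by simp
  next
    case (step j)
    then show ?case using Suc.prems[of j] by (metis length_map)
  qed
  have split: "xs j = hd (xs j) # tl (xs j)" if "j \<ge> 1" for j
    using len[OF that] by (cases "xs j") auto
  have hdtl: "hd (xs j) \<in> C j \<and> t j (hd (xs (Suc j))) = hd (xs j)"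
    "tl (xs j) \<in> lists (C j) \<and> map (t j) (tl (xs (Suc j))) = tl (xs j)" if "j \<ge> 1" for j
    using Suc.prems[OF that] split[OF that] split[of "Suc j"]
    by (metis Cons_in_lists_iff le_SucI list.inject list.simps(9) that)+
  obtain y where y: "y \<in> Y" "\<forall>j\<ge>1. q j y = hd (xs j)"
    using lift[of "\<lambda>j. hd (xs j)", OF hdtl(1)] by blast
  obtain ys where ys: "ys \<in> lists Y" "\<forall>j\<ge>1. map (q j) ys = tl (xs j)"
    using Suc.hyps(1)[of "\<lambda>j. tl (xs j)", OF _ hdtl(2)] len[of 1] by auto
  have "\<forall>j\<ge>1. map (q j) (y # ys) = xs j"
    using y(2) ys(2) split by (metis list.simps(9))
  then show ?case using y(1) ys(1) by (intro bexI[of _ "y # ys"]) auto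
qed

text \<open>The first component, later a coefficient or a weight, is fixed by the transition maps
  and hence constant along the tower. Only the second component has to be lifted.\<close>

lemma lift_compatible_pairs:
  fixes q :: "nat \<Rightarrow> 'a \<Rightarrow> 'b" and t :: "nat \<Rightarrow> 'b \<Rightarrow> 'b" and x :: "nat \<Rightarrow> 'w \<times> 'b"
  assumes lift: "\<And>x. (\<And>j. j \<ge> 1 \<Longrightarrow> x j \<in> C j \<and> t j (x (Suc j)) = x j) \<Longrightarrow>
                    \<exists>y\<in>Y. \<forall>j\<ge>1. q j y = x j"
    and x: "\<And>j. j \<ge> 1 \<Longrightarrow> x j \<in> UNIV \<times> C j \<and> map_prod id (t j) (x (Suc j)) = x j"
  shows "\<exists>y\<in>UNIV \<times> Y. \<forall>j\<ge>1. map_prod id (q j) y = x j"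
proof -
  have const: "fst (x j) = fst (x 1)" if "j \<ge> 1" for j
    using that
  proof (induction j rule: dec_induct)
    case (step j)
    then show ?case using x[of j] by (metis fst_map_prod id_apply)
  qed simp
  have snd: "snd (x j) \<in> C j \<and> t j (snd (x (Suc j))) = snd (x j)" if "j \<ge> 1" for j
    using x[OF that] by (metis mem_Times_iff snd_map_prod)
  obtain y where y: "y \<in> Y" "\<forall>j\<ge>1. q j y = snd (x j)"
    using lift[of "\<lambda>j. snd (x j)", OF snd] by blast
  have "map_prod id (q j) (fst (x 1), y) = x j" if "j \<ge> 1" for j
    using y(2) const[OF that] that by (simp add: prod_eq_iff)
  then show ?thesis using y(1) by blast
qed

section \<open>Functoriality of the integral group ring\<close>

text \<open>The additive map of integral group rings induced by \<open>f\<close>; for a homomorphism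
  it is the usual ring map.\<close>

definition group_ring_map :: "('a \<Rightarrow> 'b) \<Rightarrow> ('a \<Rightarrow>\<^sub>0 int) \<Rightarrow> ('b \<Rightarrow>\<^sub>0 int)" where
  "group_ring_map f = frag_extend (frag_of \<circ> f)"

lemma group_ring_map_of [simp]: "group_ring_map f (frag_of x) = frag_of (f x)"
  and group_ring_map_0 [simp]: "group_ring_map f 0 = 0"
  and group_ring_map_diff: "group_ring_map f (a - b) = group_ring_map f a - group_ring_map f b"
  and group_ring_map_add: "group_ring_map f (a + b) = group_ring_map f a + group_ring_map f b"
  and group_ring_map_cmul: "group_ring_map f (frag_cmul c a) = frag_cmul c (group_ring_map f a)"
  by (simp_all add: group_ring_map_def frag_extend_diff frag_extend_add frag_extend_cmul)

lemma group_ring_mult_of [simp]: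
  "frag_of x \<otimes>\<^bsub>group_ring G\<^esub> frag_of y = frag_of (x \<otimes>\<^bsub>G\<^esub> y)"
  by (simp add: group_ring_def)

lemma group_ring_mult_diff_left:
    "(a - b) \<otimes>\<^bsub>group_ring G\<^esub> c = a \<otimes>\<^bsub>group_ring G\<^esub> c - b \<otimes>\<^bsub>group_ring G\<^esub> c"
  by (simp add: group_ring_def frag_extend_diff)

lemma group_ring_mult_diff_right:
    "a \<otimes>\<^bsub>group_ring G\<^esub> (b - c) = a \<otimes>\<^bsub>group_ring G\<^esub> b - a \<otimes>\<^bsub>group_ring G\<^esub> c"
proof -
  \<comment> \<open>In the product the right factor sits inside the function being extended, so
    linearity in that function is required.\<close>
  have "frag_extend (\<lambda>x. f x - g x) a = frag_extend f a - frag_extend g a" for f g :: "'a \<Rightarrow> ('a \<Rightarrow>\<^sub>0 int)"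
  proof -
    have "frag_extend f a = frag_extend (\<lambda>x. f x - g x) a + frag_extend g a"
      by (simp add: frag_extend_def flip: frag_cmul_distrib2 sum.distrib)
    then show ?thesis by simp
  qed
  then show ?thesis by (simp add: group_ring_def frag_extend_diff)
qed

lemma group_ring_mult_0 [simp]:
  "0 \<otimes>\<^bsub>group_ring G\<^esub> a = 0" "a \<otimes>\<^bsub>group_ring G\<^esub> 0 = 0"
  by (simp_all add: group_ring_def frag_extend_eq_0)

text \<open>Both sides are biadditive, so the claim reduces to basis elements, where it is
  multiplicativity of \<open>f\<close>.\<close>

lemma group_ring_map_mult:
  assumes f: "f \<in> hom G K"
    and a: "Poly_Mapping.keys a \<subseteq> carrier G" and b: "Poly_Mapping.keys b \<subseteq> carrier G"
  shows "group_ring_map f (a \<otimes>\<^bsub>group_ring G\<^esub> b) =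
           group_ring_map f a \<otimes>\<^bsub>group_ring K\<^esub> group_ring_map f b"
  using a
proof (induction a rule: frag_induction)
  case (one x)
  from b show ?case
    by (induction b rule: frag_induction)
       (use f one in \<open>simp_all add: hom_mult group_ring_mult_diff_right group_ring_map_diff\<close>)
qed (simp_all add: group_ring_mult_diff_left group_ring_map_diff)

lemma aug_prod_Nil [simp]: "aug_prod G [] = frag_of \<one>\<^bsub>G\<^esub>"
  and aug_prod_Cons [simp]: "aug_prod G ((w, x) # ws) =
    (frag_of x - frag_of \<one>\<^bsub>G\<^esub>) \<otimes>\<^bsub>group_ring G\<^esub> aug_prod G ws"
  by (simp_all add: aug_prod_def group_ring_def)

lemma keys_aug_prod:
  assumes "group G" "snd ` set ws \<subseteq> carrier G"
  shows "Poly_Mapping.keys (aug_prod G ws) \<subseteq> carrier G"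
proof -
  interpret group G by fact
  interpret R: ring "group_ring G" by (rule ring_group_ring) fact
  have carrier: "carrier (group_ring G) = {c. Poly_Mapping.keys c \<subseteq> carrier G}"
    by (simp add: group_ring_def)
  show ?thesis
    using assms(2)
  proof (induction ws)
    case (Cons p ws)
    obtain w x where p: "p = (w, x)" by fastforce
    have "frag_of x - frag_of \<one>\<^bsub>G\<^esub> \<in> carrier (group_ring G)"
      using Cons.prems keys_diff[of "frag_of x" "frag_of \<one>\<^bsub>G\<^esub>"] by (auto simp: carrier p)
    then show ?case
      using R.m_closed[of "frag_of x - frag_of \<one>\<^bsub>G\<^esub>" "aug_prod G ws"] Cons by (simp add: carrier p)
  qed simp
qed

lemma aug_prod_map:
  assumes "group G" "group K" and f: "f \<in> hom G K" and "snd ` set ws \<subseteq> carrier G"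
  shows "aug_prod K (map (map_prod id f) ws) = group_ring_map f (aug_prod G ws)"
  using assms(4)
proof (induction ws)
  case Nil
  then show ?case using hom_one[OF f \<open>group G\<close> \<open>group K\<close>] by simp
next
  case (Cons p ws)
  interpret group G by fact
  obtain w x where p: "p = (w, x)" by fastforce
  have "Poly_Mapping.keys (frag_of x - frag_of \<one>\<^bsub>G\<^esub>) \<subseteq> carrier G"
    using Cons.prems keys_diff[of "frag_of x" "frag_of \<one>\<^bsub>G\<^esub>"] by (auto simp: p)
  then show ?case
    using Cons keys_aug_prod[OF \<open>group G\<close>, of ws] hom_one[OF f \<open>group G\<close> \<open>group K\<close>]
    by (simp add: p group_ring_map_mult[OF f] group_ring_map_diff)
qed

text \<open>Injectivity on the support excludes cancellation: the coefficient of the image at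
  \<open>f x\<close> is the coefficient of \<open>a\<close> at \<open>x\<close>.\<close>

lemma group_ring_map_eq_0_imp:
  assumes "group_ring_map f a = 0" "inj_on f (Poly_Mapping.keys a)"
  shows "a = 0"
proof (rule ccontr)
  assume "a \<noteq> 0"
  then obtain x where x: "x \<in> Poly_Mapping.keys a" by (metis ex_in_conv keys_eq_empty)
  have "0 = Poly_Mapping.lookup (group_ring_map f a) (f x)"
    using assms(1) by simp
  also have "\<dots> = (\<Sum>i\<in>Poly_Mapping.keys a. Poly_Mapping.lookup a i * (if f x = f i then 1 else 0))"
    by (simp add: group_ring_map_def frag_extend_def lookup_sum lookup_single when_def
        cong: if_cong)
  also have "\<dots> = (\<Sum>i\<in>Poly_Mapping.keys a. if i = x then Poly_Mapping.lookup a i else 0)"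
    by (rule sum.cong) (use assms(2) x in \<open>auto dest: inj_onD\<close>)
  also have "\<dots> = Poly_Mapping.lookup a x" using x by simp
  finally show False using x by (simp add: in_keys_iff)
qed

section \<open>Losey expressions\<close>

lemma losey_value_Nil [simp]: "losey_value G [] = 0"
  and losey_value_Cons [simp]: "losey_value G ((c, ws) # W) = frag_cmul c (aug_prod G ws) + losey_value G W"
  and losey_value_append [simp]: "losey_value G (W @ W') = losey_value G W + losey_value G W'"
  by (simp_all add: losey_value_def)

lemma keys_losey_value:
  assumes "group G" "\<And>c ws. (c, ws) \<in> set W \<Longrightarrow> snd ` set ws \<subseteq> carrier G"
  shows "Poly_Mapping.keys (losey_value G W) \<subseteq> carrier G"
  using assms(2)
proof (induction W)
  case (Cons p W)
  obtain c ws where p: "p = (c, ws)" by fastforce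
  have "Poly_Mapping.keys (aug_prod G ws) \<subseteq> carrier G"
    using keys_aug_prod[OF assms(1)] Cons.prems[of c ws] p by simp
  moreover have "Poly_Mapping.keys (losey_value G W) \<subseteq> carrier G"
    using Cons by (metis list.set_intros(2))
  ultimately show ?case
    using keys_add[of "frag_cmul c (aug_prod G ws)" "losey_value G W"]
      keys_cmul[of c "aug_prod G ws"] p by auto
qed simp

definition map_terms :: "('a \<Rightarrow> 'b) \<Rightarrow> 'a losey_terms \<Rightarrow> 'b losey_terms" where
  "map_terms f = map (map_prod id (map (map_prod id f)))"

lemma losey_width_map_terms [simp]: "losey_width (map_terms f W) = losey_width W"
  by (simp add: losey_width_def map_terms_def o_def case_prod_unfold)

lemma losey_value_map_terms:
  assumes "group G" "group K" "f \<in> hom G K"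
    and "\<And>c ws. (c, ws) \<in> set W \<Longrightarrow> snd ` set ws \<subseteq> carrier G"
  shows "losey_value K (map_terms f W) = group_ring_map f (losey_value G W)"
  using assms(4)
proof (induction W)
  case (Cons p W)
  obtain c ws where p: "p = (c, ws)" by fastforce
  have "losey_value K (map_terms f W) = group_ring_map f (losey_value G W)"
    using Cons by (metis list.set_intros(2))
  moreover have "aug_prod K (map (map_prod id f) ws) = group_ring_map f (aug_prod G ws)"
    using aug_prod_map[OF assms(1-3)] Cons.prems[of c ws] p by simp
  ultimately show ?case
    by (simp add: map_terms_def p group_ring_map_add group_ring_map_cmul)
qed (simp add: map_terms_def)

lemma losey_expression_carrier:
  assumes "losey_expression G H d a W" "\<And>w. w \<ge> 1 \<Longrightarrow> H w \<subseteq> carrier G" "(c, ws) \<in> set W"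
  shows "snd ` set ws \<subseteq> carrier G"
  using assms by (fastforce simp: losey_expression_def weighted_factors_def)

lemma weighted_factors_map:
  assumes "weighted_factors H d ws" "\<And>w. w \<ge> 1 \<Longrightarrow> f ` H w \<subseteq> H' w"
  shows "weighted_factors H' d (map (map_prod id f) ws)"
  using assms by (fastforce simp: weighted_factors_def o_def)

text \<open>Serves twice: for the projections \<open>q j\<close>, which push an expression over
  \<open>G\<close> down to each level, and for the transition maps \<open>t j\<close>, which make
  the levelwise expressions a tower.\<close>

lemma losey_expression_map_terms:
  assumes "group G" "group K" "f \<in> hom G K"
    and HG: "\<And>w. w \<ge> 1 \<Longrightarrow> H w \<subseteq> carrier G" and fH: "\<And>w. w \<ge> 1 \<Longrightarrow> f ` H w \<subseteq> H' w"
    and W: "losey_expression G H d a W"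
  shows "losey_expression K H' d (group_ring_map f a) (map_terms f W)"
proof -
  have "c \<noteq> 0 \<and> weighted_factors H' d ws" if cws: "(c, ws) \<in> set (map_terms f W)" for c ws
  proof -
    obtain vs where "(c, vs) \<in> set W" "ws = map (map_prod id f) vs"
      using cws by (auto simp: map_terms_def)
    then show ?thesis
      using W weighted_factors_map[OF _ fH] by (fastforce simp: losey_expression_def)
  qed
  moreover have "losey_value K (map_terms f W) = group_ring_map f a"
    using losey_value_map_terms[OF assms(1-3) losey_expression_carrier[OF W HG]] W
    by (simp add: losey_expression_def)
  ultimately show ?thesis by (auto simp: losey_expression_def)
qed

section \<open>Losey expressions describe the filtration\<close>

lemma weighted_factors_aug_prod_carrier:
  assumes "group G" "\<And>w. w \<ge> 1 \<Longrightarrow> H w \<subseteq> carrier G" "weighted_factors H m ws"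
  shows "aug_prod G ws \<in> carrier (group_ring G)"
  using keys_aug_prod[OF assms(1), of ws] assms(2,3)
  by (fastforce simp: group_ring_def weighted_factors_def)

text \<open>Elements of a generated subgroup are integral combinations of generators: generators and
  their inverses are terms with coefficient \<open>1\<close> or \<open>-1\<close>, sums are
  concatenations, and zero is the empty list. Conversely the subgroup absorbs integer multiples and
  sums.\<close>

lemma A_filt_iff_losey_expression:
  assumes "group G" and HG: "\<And>w. w \<ge> 1 \<Longrightarrow> H w \<subseteq> carrier G"
  shows "a \<in> A_filt G H m \<longleftrightarrow> (\<exists>W. losey_expression G H m a W)"
proof -
  interpret R: ring "group_ring G" by (rule ring_group_ring) fact
  let ?A = "add_monoid (group_ring G)"
  let ?S = "aug_prod G ` {ws. weighted_factors H m ws}"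
  have zero: "\<one>\<^bsub>?A\<^esub> = 0" and plus: "x \<otimes>\<^bsub>?A\<^esub> y = x + y" for x y
    by (simp_all add: group_ring_def)
  have S: "?S \<subseteq> carrier ?A"
    using weighted_factors_aug_prod_carrier[OF assms] by auto
  have inv: "inv\<^bsub>?A\<^esub> x = - x" if "x \<in> carrier ?A" for x
  using that by (intro group.inv_equality R.a_group) (simp_all add: group_ring_def)
  have sub: "subgroup (A_filt G H m) ?A"
    unfolding A_filt_def by (rule R.add.generate_is_subgroup) (use S in simp)
  have z: "0 \<in> A_filt G H m" using subgroup.one_closed[OF sub] by (simp only: zero)
  have p: "x + y \<in> A_filt G H m" if "x \<in> A_filt G H m" "y \<in> A_filt G H m" for x y
    using subgroup.m_closed[OF sub that] by (simp only: plus)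
  have m: "- x \<in> A_filt G H m" if "x \<in> A_filt G H m" for x
    using subgroup.m_inv_closed[OF sub that] inv[OF subgroup.mem_carrier[OF sub that]] by simp
  have cm: "frag_cmul c x \<in> A_filt G H m" if x: "x \<in> A_filt G H m" for c x
  \<comment> \<open>Induction runs upwards and downwards from \<open>0\<close>, adding
    \<open>x\<close> or \<open>- x\<close> at each step.\<close>
  proof (induction c rule: int_induct[of _ 0])
    case (step1 i)
    then show ?case using p[OF step1(2) x] by (simp add: frag_cmul_distrib)
  next
    case (step2 i)
    then show ?case using p[OF step2(2) m[OF x]]
      by (simp add: frag_cmul_distrib diff_conv_add_uminus del: add_uminus_conv_diff)
  qed (simp add: z)
  show ?thesis
  proof
    assume "a \<in> A_filt G H m"
    then show "\<exists>W. losey_expression G H m a W"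
      unfolding A_filt_def
    proof (induction rule: generate.induct)
      case one
      show ?case by (rule exI[of _ "[]"]) (simp add: losey_expression_def zero group_ring_def)
    next
      case (incl h)
      then obtain ws where "weighted_factors H m ws" "h = aug_prod G ws" by blast
      then show ?case by (intro exI[of _ "[(1, ws)]"]) (simp add: losey_expression_def)
    next
      case (inv h)
      then obtain ws where ws: "weighted_factors H m ws" "h = aug_prod G ws" by blast
      have "inv\<^bsub>?A\<^esub> h = - h" using S inv \<open>h \<in> ?S\<close> \<open>\<And>x. x \<in> carrier ?A \<Longrightarrow> inv\<^bsub>?A\<^esub> x = - x\<close> by blast
      then show ?case using ws by (intro exI[of _ "[(-1, ws)]"]) (simp add: losey_expression_def)
    next
      case (eng h1 h2)
      then obtain W1 W2 where "losey_expression G H m h1 W1" "losey_expression G H m h2 W2" by blast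
      then show ?case
        by (intro exI[of _ "W1 @ W2"]) (auto simp: losey_expression_def plus[simplified])
    qed
  next
    assume "\<exists>W. losey_expression G H m a W"
    then obtain W where "\<forall>(c, ws)\<in>set W. c \<noteq> 0 \<and> weighted_factors H m ws" "a = losey_value G W"
      by (auto simp: losey_expression_def)
    then show "a \<in> A_filt G H m"
    proof (induction W arbitrary: a)
      case (Cons u W)
      obtain c ws where u: "u = (c, ws)" by fastforce
      have "aug_prod G ws \<in> A_filt G H m"
        unfolding A_filt_def using Cons.prems(1) u by (intro generate.incl) auto
      then show ?case using Cons u by (auto intro!: p cm)
    qed (simp add: z)
  qed
qed

lemma D_alg_iff_losey_expression:
  assumes "group G" "\<And>w. w \<ge> 1 \<Longrightarrow> H w \<subseteq> carrier G" "g \<in> carrier G"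
  shows "g \<in> D_alg G H m \<longleftrightarrow> (\<exists>W. losey_expression G H m (frag_of g - frag_of \<one>\<^bsub>G\<^esub>) W)"
proof -
  have "frag_of g = frag_of \<one>\<^bsub>G\<^esub> + a \<longleftrightarrow> a = frag_of g - frag_of \<one>\<^bsub>G\<^esub>" for a
    by (auto simp: algebra_simps)
  then show ?thesis
    unfolding D_alg_def image_iff
    using A_filt_iff_losey_expression[OF assms(1), of H, OF assms(2)] assms(3) by auto
qed

lemma losey_mu_le:
  assumes "losey_expression G H (n + 1) (frag_of h - frag_of \<one>\<^bsub>G\<^esub>) W"
  shows "losey_mu G H n h \<le> losey_width W"
  unfolding losey_mu_def using assms by (intro cInf_lower) auto

text \<open>A nonempty set of natural numbers contains its infimum. The given \<open>W0\<close>
  supplies nonemptiness; otherwise \<open>losey_mu\<close> would not be the width of any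
  expression.\<close>

lemma losey_mu_attained:
  assumes "losey_expression G H (n + 1) (frag_of h - frag_of \<one>\<^bsub>G\<^esub>) W0"
  obtains W where "losey_expression G H (n + 1) (frag_of h - frag_of \<one>\<^bsub>G\<^esub>) W"
    "losey_width W = losey_mu G H n h"
proof -
  have "losey_mu G H n h \<in> losey_width ` {W. losey_expression G H (n + 1) (frag_of h - frag_of \<one>\<^bsub>G\<^esub>) W}"
    unfolding losey_mu_def using assms by (intro Inf_nat_def1) auto
  then show ?thesis using that by auto
qed

section \<open>Capping weights\<close>

definition cap_weights :: "nat \<Rightarrow> 'a losey_terms \<Rightarrow> 'a losey_terms" where
  "cap_weights N = map (map_prod id (map (map_prod (min N) id)))"

lemma losey_width_cap_weights [simp]: "losey_width (cap_weights N W) = losey_width W"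
  by (simp add: losey_width_def cap_weights_def o_def case_prod_unfold)

lemma aug_prod_cap: "aug_prod G (map (map_prod g id) ws) = aug_prod G ws"
  by (induction ws) auto

text \<open>Either some entry is at least \<open>N\<close>, and its cap alone contributes
  \<open>N\<close>, or capping changes nothing.\<close>

lemma min_sum_list_le: "min N (sum_list ws) \<le> sum_list (map (min N) ws)" for N :: nat
  by (induction ws) auto

text \<open>In a descending series a smaller weight is a weaker membership condition, and the total
  weight only has to reach \<open>N\<close>, which capping at \<open>N\<close> preserves.\<close>

lemma weighted_factors_cap:
  assumes "weighted_factors H N ws" "N \<ge> 1" "\<And>a b. 1 \<le> a \<Longrightarrow> a \<le> b \<Longrightarrow> H b \<subseteq> H a"
  shows "weighted_factors H N (map (map_prod (min N) id) ws)"
proof -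
  have "N \<le> sum_list (map (min N) (map fst ws))"
    using min_sum_list_le[of N "map fst ws"] assms(1) by (auto simp: weighted_factors_def)
  moreover have "x \<in> H (min N w)" "1 \<le> min N w" if "(w, x) \<in> set ws" for w x
    using that assms(1,2) assms(3)[of "min N w" w] by (fastforce simp: weighted_factors_def)+
  ultimately show ?thesis by (auto simp: weighted_factors_def o_def)
qed

text \<open>Weights are mere labels for \<open>aug_prod\<close>, so changing them leaves the value
  alone.\<close>

lemma losey_expression_cap:
  assumes "losey_expression G H N a W" "N \<ge> 1" "\<And>a b. 1 \<le> a \<Longrightarrow> a \<le> b \<Longrightarrow> H b \<subseteq> H a"
  shows "losey_expression G H N a (cap_weights N W)"
proof -
  have "losey_value G (cap_weights N W) = losey_value G W"
    by (simp add: losey_value_def cap_weights_def o_def case_prod_unfold aug_prod_cap)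
  then show ?thesis
    using assms(1) weighted_factors_cap[OF _ assms(2,3)]
    by (fastforce simp: losey_expression_def cap_weights_def)
qed

text \<open>A box that contains all capped expressions of width at most \<open>B\<close>. Membership
  of the factors in the series is imposed separately, through
  \<open>losey_expression\<close>.\<close>

definition bounded_terms :: "nat \<Rightarrow> nat \<Rightarrow> 'a set \<Rightarrow> 'a losey_terms set" where
  "bounded_terms N B C = {W. losey_width W \<le> B \<and>
     (\<forall>(c, ws)\<in>set W. c \<noteq> 0 \<and> set ws \<subseteq> {..N} \<times> C)}"

text \<open>A term with nonzero coefficient \<open>c\<close> and \<open>r\<close> factors costs at
  least \<open>1\<close>, at least the absolute value of \<open>c\<close>, and more than
  \<open>r\<close>. Thus \<open>B\<close> bounds the number of terms, the coefficients and the
  lengths; terms with coefficient zero would cost nothing.\<close>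

lemma finite_bounded_terms:
  assumes "finite C"
  shows "finite (bounded_terms N B C)"
proof (rule finite_subset)
  let ?F = "{- int B..int B} \<times> {ws. set ws \<subseteq> {..N} \<times> C \<and> length ws \<le> B}"
  show "finite {W. set W \<subseteq> ?F \<and> length W \<le> B}"
    by (intro finite_lists_length_le finite_cartesian_product) (use assms in auto)
  show "bounded_terms N B C \<subseteq> {W. set W \<subseteq> ?F \<and> length W \<le> B}"
  proof
    fix W :: "'a losey_terms"
    assume W: "W \<in> bounded_terms N B C"
    have summand: "1 \<le> nat \<bar>c\<bar>" "set ws \<subseteq> {..N} \<times> C" if "(c, ws) \<in> set W" for c ws
      using W that by (auto simp: bounded_terms_def)
    have "length W \<le> losey_width W"
      using summand(1)
    proof (induction W)
      case (Cons p W)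
      obtain c ws where p: "p = (c, ws)" by fastforce
      have "length W \<le> losey_width W" using Cons by (metis list.set_intros(2))
      moreover have "1 \<le> nat \<bar>c\<bar>" using Cons.prems[of c ws] p by simp
      then have "1 \<le> nat \<bar>c\<bar> * (1 + length ws)" by simp
      ultimately show ?case by (simp add: losey_width_def p)
    qed simp
    moreover have "nat \<bar>c\<bar> \<le> B \<and> length ws \<le> B" if "(c, ws) \<in> set W" for c ws
    proof -
      have "nat \<bar>c\<bar> * (1 + length ws) \<le> losey_width W"
        unfolding losey_width_def by (rule member_le_sum_list) (use that in force)+
      moreover have "nat \<bar>c\<bar> \<le> nat \<bar>c\<bar> * (1 + length ws)" by simp
      moreover have "length ws \<le> nat \<bar>c\<bar> * (1 + length ws)"
        using mult_le_mono1[OF summand(1)[OF that], of "1 + length ws"] by simp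
      ultimately show ?thesis using W unfolding bounded_terms_def by force
    qed
    ultimately show "W \<in> {W. set W \<subseteq> ?F \<and> length W \<le> B}"
      using W summand(2) by (force simp: bounded_terms_def)
  qed
qed

lemma cap_weights_bounded_terms:
  assumes "losey_expression G H d a W" "\<And>w. w \<ge> 1 \<Longrightarrow> H w \<subseteq> carrier G" "losey_width W \<le> B"
  shows "cap_weights N W \<in> bounded_terms N B (carrier G)"
proof -
  have "c \<noteq> 0 \<and> set ws \<subseteq> {..N} \<times> carrier G" if cws: "(c, ws) \<in> set (cap_weights N W)" for c ws
  proof -
    obtain vs where vs: "(c, vs) \<in> set W" "ws = map (map_prod (min N) id) vs"
      using cws by (auto simp: cap_weights_def)
    show ?thesis
      using losey_expression_carrier[OF assms(1,2) vs(1)] vs assms(1)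
      by (fastforce simp: losey_expression_def)
  qed
  then show ?thesis using assms(3) by (auto simp: bounded_terms_def)
qed

lemma map_terms_bounded_terms:
  assumes "W \<in> bounded_terms N B C" "f ` C \<subseteq> C'"
  shows "map_terms f W \<in> bounded_terms N B C'"
proof -
  have "c \<noteq> 0 \<and> set ws \<subseteq> {..N} \<times> C'" if cws: "(c, ws) \<in> set (map_terms f W)" for c ws
  proof -
    obtain vs where vs: "(c, vs) \<in> set W" "ws = map (map_prod id f) vs"
      using cws by (auto simp: map_terms_def)
    show ?thesis
      using vs assms by (fastforce simp: bounded_terms_def)
  qed
  then show ?thesis using assms(1) by (auto simp: bounded_terms_def)
qed

section \<open>Profinite towers\<close>

context profinite_tower
begin

lemma group_Q: "j \<ge> 1 \<Longrightarrow> group (Q j)"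
  and finite_Q: "j \<ge> 1 \<Longrightarrow> finite (carrier (Q j))"
  and t_hom: "j \<ge> 1 \<Longrightarrow> t j \<in> hom (Q (Suc j)) (Q j)"
  and q_hom: "j \<ge> 1 \<Longrightarrow> q j \<in> hom G (Q j)"
  using finite_group transition quotient by (auto simp: epi_def)

lemma q_closed: "j \<ge> 1 \<Longrightarrow> g \<in> carrier G \<Longrightarrow> q j g \<in> carrier (Q j)"
  using q_hom by (auto simp: hom_def)

lemma q_one: "j \<ge> 1 \<Longrightarrow> q j \<one> = \<one>\<^bsub>Q j\<^esub>"
  using hom_one[OF q_hom group_axioms group_Q] .

text \<open>The inverse-limit isomorphism as a bijection onto compatible families. Its range,
  injectivity and surjectivity yield \<open>t_q\<close>, \<open>separated\<close> and
  \<open>lift_compatible\<close> respectively.\<close>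

lemma limit_bij: "bij_betw (\<lambda>g. \<lambda>j\<in>{1..}. q j g) (carrier G)
    {x \<in> (\<Pi>\<^sub>E j\<in>{1..}. carrier (Q j)). \<forall>j\<ge>1. t j (x (Suc j)) = x j}"
  using limit by (simp add: iso_def inverse_limit_def)

lemma t_q:
  assumes "j \<ge> 1" "g \<in> carrier G"
  shows "t j (q (Suc j) g) = q j g"
  using bij_betwE[OF limit_bij] assms by auto

lemma separated:
  assumes "x \<in> carrier G" "y \<in> carrier G" "\<And>j. j \<ge> 1 \<Longrightarrow> q j x = q j y"
  shows "x = y"
  using bij_betw_imp_inj_on[OF limit_bij] assms
  by (auto intro!: inj_onD[of "\<lambda>g. \<lambda>j\<in>{1..}. q j g" "carrier G"] restrict_ext)

lemma lift_compatible:
  assumes "\<And>j. j \<ge> 1 \<Longrightarrow> x j \<in> carrier (Q j) \<and> t j (x (Suc j)) = x j"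
  shows "\<exists>y\<in>carrier G. \<forall>j\<ge>1. q j y = x j"
proof -
  \<comment> \<open>Points of the product are extensional functions, so the value at index
    \<open>0\<close> must be made undefined first.\<close>
  have "restrict x {1..} \<in> {x \<in> (\<Pi>\<^sub>E j\<in>{1..}. carrier (Q j)). \<forall>j\<ge>1. t j (x (Suc j)) = x j}"
    using assms by auto
  then have "restrict x {1..} \<in> (\<lambda>g. \<lambda>j\<in>{1..}. q j g) ` carrier G"
    using bij_betw_imp_surj_on[OF limit_bij] by blast
  then obtain y where "y \<in> carrier G" "restrict x {1..} = (\<lambda>j\<in>{1..}. q j y)" by blast
  then show ?thesis by (metis atLeast_iff restrict_apply)
qed

lemma lift_compatible_terms:
  assumes "\<And>j c ws. \<lbrakk>j \<ge> 1; (c, ws) \<in> set (W j)\<rbrakk> \<Longrightarrow> snd ` set ws \<subseteq> carrier (Q j)"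
    and "\<And>j. j \<ge> 1 \<Longrightarrow> map_terms (t j) (W (Suc j)) = W j"
  obtains V where "\<And>j. j \<ge> 1 \<Longrightarrow> map_terms (q j) V = W j"
    "\<And>c ws. (c, ws) \<in> set V \<Longrightarrow> snd ` set ws \<subseteq> carrier G"
proof -
  have W: "W j \<in> lists (UNIV \<times> lists (UNIV \<times> carrier (Q j)))" if "j \<ge> 1" for j
    using assms(1)[OF that] by (fastforce simp: in_lists_conv_set)
  \<comment> \<open>The four facts follow the type of an expression from the inside out: weighted
    element, product, term with coefficient, list of terms.\<close>
  note pairs = lift_compatible_pairs[of "\<lambda>j. carrier (Q j)" t "carrier G" q, OF lift_compatible]
  note lists = lift_compatible_lists[OF pairs]
  note pairs' = lift_compatible_pairs[OF lists]
  note lists' = lift_compatible_lists[OF pairs']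
  have "\<exists>V\<in>lists (UNIV \<times> lists (UNIV \<times> carrier G)). \<forall>j\<ge>1. map_terms (q j) V = W j"
    unfolding map_terms_def
    by (rule lists') (use W assms(2) in \<open>auto simp: map_terms_def\<close>)
  then obtain V where V: "V \<in> lists (UNIV \<times> lists (UNIV \<times> carrier G))"
    "\<forall>j\<ge>1. map_terms (q j) V = W j" by blast
  show ?thesis
    by (rule that[of V]) (use V in \<open>fastforce simp: in_lists_conv_set\<close>)+
qed

text \<open>Two elements that differ at one level differ at all later ones, because
  \<open>t_q\<close> would carry an equality downwards. Finitely many pairs are therefore separated
  by a common level.\<close>

lemma inj_on_finite_level:
  assumes "finite K" "K \<subseteq> carrier G"
  obtains j where "j \<ge> 1" "inj_on (q j) K"
proof -
  have pair: "\<forall>\<^sub>F k in sequentially. q k x = q k y \<longrightarrow> x = y"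
    if xy: "x \<in> carrier G" "y \<in> carrier G" for x y
  proof (cases "x = y")
    case False
    then obtain j where j: "j \<ge> 1" "q j x \<noteq> q j y" using separated[OF xy] by metis
    have "q k x \<noteq> q k y" if "k \<ge> j" for k
      using that
    proof (induction k rule: dec_induct)
      case (step k)
      then show ?case using t_q[of k] xy j(1) by (metis order_trans)
    qed (use j in simp)
    then show ?thesis unfolding eventually_sequentially by blast
  qed simp
  have "\<forall>\<^sub>F k in sequentially. \<forall>x\<in>K. \<forall>y\<in>K. q k x = q k y \<longrightarrow> x = y"
    using assms pair by (intro eventually_ball_finite ballI) auto
  then have "\<forall>\<^sub>F k in sequentially. k \<ge> 1 \<and> inj_on (q k) K"
    using eventually_ge_at_top[of 1] by eventually_elim (auto simp: inj_on_def)
  then show ?thesis using that eventually_happens'[OF sequentially_bot] by blast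
qed

lemma group_ring_separated:
  assumes "Poly_Mapping.keys a \<subseteq> carrier G" "Poly_Mapping.keys b \<subseteq> carrier G"
    and "\<And>j. j \<ge> 1 \<Longrightarrow> group_ring_map (q j) a = group_ring_map (q j) b"
  shows "a = b"
proof -
  have "Poly_Mapping.keys (a - b) \<subseteq> carrier G"
    using keys_diff[of a b] assms(1,2) by blast
  then obtain j where "j \<ge> 1" "inj_on (q j) (Poly_Mapping.keys (a - b))"
    using inj_on_finite_level[OF finite_keys] by blast
  then have "a - b = 0"
    using assms(3) by (intro group_ring_map_eq_0_imp[of "q j"]) (simp_all add: group_ring_map_diff)
  then show ?thesis by simp
qed

end

section \<open>From bounded levelwise expressions to an expression over \<open>G\<close>\<close>

context closed_induced_N_series
begin

lemma H_carrier: "w \<ge> 1 \<Longrightarrow> H w \<subseteq> carrier G"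
  using N_series subgroup.subset unfolding N_series_def by blast

lemma H_antimono:
  assumes "1 \<le> a" "a \<le> b"
  shows "H b \<subseteq> H a"
  using assms(2)
proof (induction b rule: dec_induct)
  case (step b)
  have "1 \<le> b" using assms(1) step(1) by simp
  then have "H (Suc b) \<subseteq> H b" using N_series unfolding N_series_def by blast
  then show ?case using step.IH by blast
qed simp

lemma quotient_series_carrier: "j \<ge> 1 \<Longrightarrow> w \<ge> 1 \<Longrightarrow> quotient_series q H j w \<subseteq> carrier (Q j)"
  unfolding quotient_series_def using H_carrier q_closed by blast

lemma quotient_series_antimono:
  "1 \<le> a \<Longrightarrow> a \<le> b \<Longrightarrow> quotient_series q H j b \<subseteq> quotient_series q H j a"
  unfolding quotient_series_def using H_antimono by blast

text \<open>Everything is detected on the finite levels: membership in \<open>H w\<close> by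
  \<open>induced\<close>, and the value by \<open>group_ring_separated\<close>.\<close>

lemma losey_expression_lift:
  assumes h: "h \<in> carrier G"
    and V: "\<And>j. j \<ge> 1 \<Longrightarrow> losey_expression (Q j) (quotient_series q H j) d
              (frag_of (q j h) - frag_of \<one>\<^bsub>Q j\<^esub>) (map_terms (q j) V)"
    and carr: "\<And>c ws. (c, ws) \<in> set V \<Longrightarrow> snd ` set ws \<subseteq> carrier G"
  shows "losey_expression G H d (frag_of h - frag_of \<one>) V"
proof -
  have "c \<noteq> 0 \<and> weighted_factors H d ws" if cws: "(c, ws) \<in> set V" for c ws
  proof -
    have *: "c \<noteq> 0 \<and> weighted_factors (quotient_series q H j) d (map (map_prod id (q j)) ws)"
      if "j \<ge> 1" for j
    proof -
      have "(c, map (map_prod id (q j)) ws) \<in> set (map_terms (q j) V)"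
        unfolding map_terms_def using cws by force
      then show ?thesis using V[OF that] by (auto simp: losey_expression_def)
    qed
    have "x \<in> H w" "1 \<le> w" if wx: "(w, x) \<in> set ws" for w x
    proof -
      have q: "1 \<le> w \<and> q j x \<in> quotient_series q H j w" if "j \<ge> 1" for j
        using *[OF that] wx by (force simp: weighted_factors_def)
      then show "1 \<le> w" by blast
      then show "x \<in> H w" using q carr[OF cws] wx by (subst induced) force+
    qed
    \<comment> \<open>Coefficients and weights do not change under projection, so level
      \<open>1\<close> already gives the nonvanishing and the total weight.\<close>
    then show ?thesis using *[of 1] by (auto simp: weighted_factors_def o_def)
  qed
  moreover have "frag_of h - frag_of \<one> = losey_value G V"
  proof (rule group_ring_separated)
    show "Poly_Mapping.keys (frag_of h - frag_of \<one>) \<subseteq> carrier G"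
      using keys_diff[of "frag_of h" "frag_of \<one>"] h by auto
    show "Poly_Mapping.keys (losey_value G V) \<subseteq> carrier G"
      by (rule keys_losey_value[OF group_axioms carr])
    fix j :: nat
    assume j: "j \<ge> 1"
    show "group_ring_map (q j) (frag_of h - frag_of \<one>) = group_ring_map (q j) (losey_value G V)"
      using V[OF j] losey_value_map_terms[OF group_axioms group_Q[OF j] q_hom[OF j] carr] q_one[OF j]
      by (simp add: losey_expression_def group_ring_map_diff)
  qed
  ultimately show ?thesis by (auto simp: losey_expression_def)
qed

lemma losey_expression_of_bounded:
  assumes h: "h \<in> carrier G" and "d \<ge> 1"
    and bounded: "\<And>j. j \<ge> 1 \<Longrightarrow> \<exists>W. losey_width W \<le> B \<and>
           losey_expression (Q j) (quotient_series q H j) d (frag_of (q j h) - frag_of \<one>\<^bsub>Q j\<^esub>) W"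
  shows "\<exists>W. losey_expression G H d (frag_of h - frag_of \<one>) W"
proof -
  \<comment> \<open>The finite sets for Koenig's lemma. Capping at \<open>d\<close> makes them
    nonempty, and pushing forward along \<open>t j\<close> connects them.\<close>
  define E where "E j = {W \<in> bounded_terms d B (carrier (Q j)).
    losey_expression (Q j) (quotient_series q H j) d (frag_of (q j h) - frag_of \<one>\<^bsub>Q j\<^esub>) W}" for j
  have fin: "finite (E j)" if "j \<ge> 1" for j
    unfolding E_def using finite_bounded_terms[OF finite_Q[OF that]] by simp
  have ne: "E j \<noteq> {}" if j: "j \<ge> 1" for j
  proof -
    obtain W where W: "losey_width W \<le> B"
      "losey_expression (Q j) (quotient_series q H j) d (frag_of (q j h) - frag_of \<one>\<^bsub>Q j\<^esub>) W"
      using bounded[OF j] by blast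
    have "cap_weights d W \<in> E j"
      unfolding E_def
      using cap_weights_bounded_terms[OF W(2) quotient_series_carrier[OF j] W(1)]
        losey_expression_cap[OF W(2) \<open>d \<ge> 1\<close> quotient_series_antimono] by simp
    then show ?thesis by blast
  qed
  have maps: "map_terms (t j) ` E (Suc j) \<subseteq> E j" if j: "j \<ge> 1" for j
  proof
    fix V assume "V \<in> map_terms (t j) ` E (Suc j)"
    then obtain W where W: "W \<in> E (Suc j)" "V = map_terms (t j) W" by blast
    have "t j ` carrier (Q (Suc j)) \<subseteq> carrier (Q j)"
      using t_hom[OF j] by (auto simp: hom_def)
    then have "V \<in> bounded_terms d B (carrier (Q j))"
      using W map_terms_bounded_terms by (auto simp: E_def)
    moreover have "losey_expression (Q j) (quotient_series q H j) d
      (group_ring_map (t j) (frag_of (q (Suc j) h) - frag_of \<one>\<^bsub>Q (Suc j)\<^esub>)) V"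
      unfolding W(2)
    proof (rule losey_expression_map_terms)
      show "losey_expression (Q (Suc j)) (quotient_series q H (Suc j)) d
        (frag_of (q (Suc j) h) - frag_of \<one>\<^bsub>Q (Suc j)\<^esub>) W"
        using W(1) by (simp add: E_def)
    qed (use j group_Q t_hom quotient_series_carrier transition_series in auto)
    ultimately show "V \<in> E j"
      \<comment> \<open>Since the targets come from one element \<open>h\<close> of
        \<open>G\<close>, the map induced by \<open>t j\<close> sends the target at level
        \<open>Suc j\<close> to that at level \<open>j\<close>.\<close>
      using t_q[OF j h] hom_one[OF t_hom[OF j] group_Q group_Q[OF j]]
      by (simp add: E_def group_ring_map_diff)
  qed
  \<comment> \<open>The tower starts at level \<open>1\<close> and Koenig's lemma at index
    \<open>0\<close>; hence the shift by one, undone by \<open>W\<close>.\<close>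
  obtain X where X: "\<And>j. X j \<in> E (Suc j)" "\<And>j. map_terms (t (Suc j)) (X (Suc j)) = X j"
    using inverse_limit_finite_nonempty[of "\<lambda>j. E (Suc j)" "\<lambda>j. map_terms (t (Suc j))"] fin ne maps
    by auto
  define W where "W j = X (j - 1)" for j
  have W: "W j \<in> E j" "map_terms (t j) (W (Suc j)) = W j" if "j \<ge> 1" for j
    using that X[of "j - 1"] by (simp_all add: W_def)
  have carr: "snd ` set ws \<subseteq> carrier (Q j)" if "j \<ge> 1" "(c, ws) \<in> set (W j)" for j c ws
    using W(1)[OF that(1)] that(2) by (fastforce simp: E_def bounded_terms_def)
  obtain V where V: "\<And>j. j \<ge> 1 \<Longrightarrow> map_terms (q j) V = W j"
    "\<And>c ws. (c, ws) \<in> set V \<Longrightarrow> snd ` set ws \<subseteq> carrier G"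
  proof (rule lift_compatible_terms[of W])
    show "snd ` set ws \<subseteq> carrier (Q j)" if "j \<ge> 1" "(c, ws) \<in> set (W j)" for j c ws
      using that by (rule carr)
    show "map_terms (t j) (W (Suc j)) = W j" if "j \<ge> 1" for j
      using that by (rule W(2))
  qed blast
  have "losey_expression G H d (frag_of h - frag_of \<one>) V"
    using V W(1) by (intro losey_expression_lift h) (auto simp: E_def)
  then show ?thesis by blast
qed

end

theorem theorem6p1:
  fixes G :: "('a, 'm) monoid_scheme"
    and Q :: "nat \<Rightarrow> ('b, 'k) monoid_scheme"
    and t :: "nat \<Rightarrow> 'b \<Rightarrow> 'b"
    and q :: "nat \<Rightarrow> 'a \<Rightarrow> 'b"
    and H :: "nat \<Rightarrow> 'a set"
    and n :: nat
    and h :: 'a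
  assumes "closed_induced_N_series G Q t q H"
    and "n \<ge> 1"
    and "h \<in> H n \<inter> D_fin G Q q H (n + 1)"
  shows "h \<in> D_alg G H (n + 1) \<longleftrightarrow>
         (SUP j\<in>{1..}. enat (losey_mu (Q j) (quotient_series q H j) n (q j h))) < \<infinity>"
proof -
  interpret closed_induced_N_series G Q t q H by fact
  let ?mu = "\<lambda>j. losey_mu (Q j) (quotient_series q H j) n (q j h)"
  let ?expr = "\<lambda>j. losey_expression (Q j) (quotient_series q H j) (n + 1)
    (frag_of (q j h) - frag_of \<one>\<^bsub>Q j\<^esub>)"
  have h: "h \<in> carrier G" using assms(3) by (simp add: D_fin_def)
  have D_alg_G: "h \<in> D_alg G H (n + 1) \<longleftrightarrow>
      (\<exists>W. losey_expression G H (n + 1) (frag_of h - frag_of \<one>\<^bsub>G\<^esub>) W)"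
    by (rule D_alg_iff_losey_expression[OF group_axioms _ h]) (rule H_carrier)
  show ?thesis
  proof
    assume "h \<in> D_alg G H (n + 1)"
    then obtain W where W: "losey_expression G H (n + 1) (frag_of h - frag_of \<one>\<^bsub>G\<^esub>) W"
      using D_alg_G by blast
    \<comment> \<open>One expression over \<open>G\<close> bounds all levels, because projection
      keeps its width.\<close>
    have "?mu j \<le> losey_width W" if j: "j \<ge> 1" for j
    proof -
      have "losey_expression (Q j) (quotient_series q H j) (n + 1)
        (group_ring_map (q j) (frag_of h - frag_of \<one>\<^bsub>G\<^esub>)) (map_terms (q j) W)"
        by (rule losey_expression_map_terms[OF group_axioms group_Q[OF j] q_hom[OF j] H_carrier _ W])
           (simp_all add: quotient_series_def)
      then have "?expr j (map_terms (q j) W)"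
        by (simp add: group_ring_map_diff q_one[OF j])
      then show ?thesis using losey_mu_le by fastforce
    qed
    then have "(SUP j\<in>{1..}. enat (?mu j)) \<le> enat (losey_width W)"
      by (intro SUP_least) simp
    then show "(SUP j\<in>{1..}. enat (?mu j)) < \<infinity>"
      using le_less_trans enat_ord_simps(4) by blast
  next
    assume "(SUP j\<in>{1..}. enat (?mu j)) < \<infinity>"
    then obtain B where B: "(SUP j\<in>{1..}. enat (?mu j)) = enat B" by (metis less_infinityE)
    have "\<exists>W. losey_width W \<le> B \<and> ?expr j W" if j: "j \<ge> 1" for j
    proof -
      \<comment> \<open>Membership in \<open>D_fin\<close> guarantees an expression at every level,
        so that \<open>?mu j\<close> is an attained minimum and the bound \<open>B\<close> on it is
        a bound on an actual width.\<close>
      have "q j h \<in> D_alg (Q j) (quotient_series q H j) (n + 1)"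
        using assms(3) j by (simp add: D_fin_def)
      then obtain W0 where "?expr j W0"
        using D_alg_iff_losey_expression[OF group_Q[OF j] _ q_closed[OF j h],
            of "quotient_series q H j", OF quotient_series_carrier[OF j]]
        by blast
      then obtain W where W: "?expr j W" "losey_width W = ?mu j"
        by (rule losey_mu_attained)
      have "enat (?mu j) \<le> enat B" unfolding B[symmetric] using j by (intro SUP_upper) simp
      then show ?thesis using W by (intro exI[of _ W]) simp
    qed
    then show "h \<in> D_alg G H (n + 1)"
      using losey_expression_of_bounded[OF h, of "n + 1" B] D_alg_G by simp
  qed
qed

end
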